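(* Let $X$ be a real linear space, $(Y,N)$ a fuzzy Banach space and $(Z,N')$ a fuzzy normed space. Let $\varphi_4: X\times X\to Z$ be a function such that for some real $\alpha>2$, $$N'\left(\varphi_4\left(\tfrac12\cdot\tfrac{x}{2},\tfrac{y}{2}\right),a\right)\ \ge\ N'\left(\varphi_4\left(\tfrac{x}{2},y\right),\alpha a\right)$$ for all $x\in X$, all $y\in\{x,\tfrac{x}{2},\tfrac{3x}{2},2x\}$ and all $a>0$, and such that $$\lim_{n\to\infty}N'\left(2^n\varphi_4(2^{-n}x,2^{-n}y),a\right)=1$$ for all $x,y\in X$ and all $a>0$. Let $f:X\to Y$ be an odd function satisfying $$N\big(f(2x+y)+f(2x-y)-f(x+y)-f(x-y)-2f(2x)+2f(x),\,a\big)\ \ge\ N'(\varphi_4(x,y),a)$$ for all $a>0$ and all $x,y\in X$. Then there exists a unique additive mapping $A:X\to Y$ such that $$N(A(x)-f(x),a)\ \ge\ N''_4\left(x,\tfrac{a(\alpha-2)}{4}\right)$$ for all $x\in X$ and all $a>0$, where $$N''_4(x,a):=\min\Big\{N'\big(\varphi_4(x,x),a\big),\,N'\big(\varphi_4(\tfrac{x}{2},\tfrac{x}{2}),a\big),\,N'\big(\varphi_4(\tfrac{x}{2},2x),a\big),\,N'\big(\varphi_4(\tfrac{x}{2},\tfrac{3x}{2}),a\big)\Big\}.$$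
   Context: Let $V$ be a real linear space. A function $N:V\times\mathbb{R}\to[0,1]$ is a fuzzy norm on $V$ if for all $x,y\in V$ and $a,b\in\mathbb{R}$: (N1) $N(x,a)=0$ for $a\le 0$; (N2) $x=0$ if and only if $N(x,a)=1$ for all $a>0$; (N3) $N(ax,b)=N(x,\frac{b}{|a|})$ if $a\ne 0$; (N4) $N(x+y,a+b)\ge\min\{N(x,a),N(y,b)\}$; (N5) $N(x,\cdot)$ is a non-decreasing function on $\mathbb{R}$ and $\lim_{a\to\infty}N(x,a)=1$; (N6) for $x\ne 0$, $N(x,\cdot)$ is upper semicontinuous on $\mathbb{R}$. The pair $(V,N)$ is then called a fuzzy normed (linear) space. A sequence $(x_n)$ in $V$ is convergent if there exists $x\in V$ with $\lim_{n\to\infty}N(x_n-x,a)=1$ for all $a>0$. It is Cauchy if for each $\epsilon>0$ and each $a>0$ there exists $n_0$ such that $N(x_{n+p}-x_n,a)>1-\epsilon$ for all $n\ge n_0$ and all $p>0$ (integers). A fuzzy Banach space is a fuzzy normed space in which every Cauchy sequence is convergent. A mapping $A:X\to Y$ is additive if $A(x+y)=A(x)+A(y)$ for all $x,y\in X$. A function $f$ is odd if $f(-x)=-f(x)$ for all $x$. *)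

theory Defs
  imports Complex_Main
begin

definition upper_semicontinuous :: "('a::topological_space \<Rightarrow> real) \<Rightarrow> bool" where
  "upper_semicontinuous f \<longleftrightarrow> (\<forall>t c. f t < c \<longrightarrow> (\<forall>\<^sub>F s in nhds t. f s < c))"

locale fuzzy_normed_space =
  fixes N :: "'v::real_vector \<Rightarrow> real \<Rightarrow> real"
  assumes range: "N x a \<in> {0..1}"
    and N1: "a \<le> 0 \<Longrightarrow> N x a = 0"
    and N2: "x = 0 \<longleftrightarrow> (\<forall>a>0. N x a = 1)"
    and N3: "c \<noteq> 0 \<Longrightarrow> N (c *\<^sub>R x) b = N x (b / \<bar>c\<bar>)"
    and N4: "N (x + y) (a + b) \<ge> min (N x a) (N y b)"
    and N5_mono: "mono (N x)"
    and N5_lim: "(N x \<longlongrightarrow> 1) at_top"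
    and N6: "x \<noteq> 0 \<Longrightarrow> upper_semicontinuous (N x)"

definition fuzzy_convergent :: "('v::real_vector \<Rightarrow> real \<Rightarrow> real) \<Rightarrow> (nat \<Rightarrow> 'v) \<Rightarrow> bool" where
  "fuzzy_convergent N X \<longleftrightarrow> (\<exists>x. \<forall>a>0. (\<lambda>n. N (X n - x) a) \<longlonglongrightarrow> 1)"

definition fuzzy_Cauchy :: "('v::real_vector \<Rightarrow> real \<Rightarrow> real) \<Rightarrow> (nat \<Rightarrow> 'v) \<Rightarrow> bool" where
  "fuzzy_Cauchy N X \<longleftrightarrow>
     (\<forall>\<epsilon>>0. \<forall>a>0. \<exists>n\<^sub>0. \<forall>n\<ge>n\<^sub>0. \<forall>p>0. N (X (n + p) - X n) a > 1 - \<epsilon>)"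

locale fuzzy_Banach_space = fuzzy_normed_space N
  for N :: "'v::real_vector \<Rightarrow> real \<Rightarrow> real" +
  assumes complete: "fuzzy_Cauchy N X \<Longrightarrow> fuzzy_convergent N X"

definition N4'' ::
  "('z \<Rightarrow> real \<Rightarrow> real) \<Rightarrow> ('x::real_vector \<Rightarrow> 'x \<Rightarrow> 'z) \<Rightarrow> 'x \<Rightarrow> real \<Rightarrow> real" where
  "N4'' N' \<phi> x a = Min {
     N' (\<phi> x x) a,
     N' (\<phi> ((1/2) *\<^sub>R x) ((1/2) *\<^sub>R x)) a,
     N' (\<phi> ((1/2) *\<^sub>R x) (2 *\<^sub>R x)) a,
     N' (\<phi> ((1/2) *\<^sub>R x) ((3/2) *\<^sub>R x)) a}"

end

theory Submission
  imports Defs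
begin

text \<open>
  Write \<open>D f x y\<close> for the defect of the functional equation. For odd \<open>f\<close>,
  \<open>2 (f (2x) - 2 f x) = D f (x/2) (2x) + D f (x/2) (3x/2) - D f x x - D f (x/2) (x/2)\<close>,
  so \<open>f (2x) - 2 f x\<close> is controlled by exactly the four control values in \<open>N4''\<close>.
  Hyers' sequence \<open>2\<^sup>n f (2\<^sup>-\<^sup>n x)\<close> is then Cauchy with geometric rate \<open>2 / \<alpha>\<close>, and its limit
  is an odd solution of \<open>D A = 0\<close>. Such an \<open>A\<close> satisfies \<open>A (3x + y) + A (3x - y) = 6 A x\<close>,
  which is Jensen's equation, and is therefore additive. The direct estimate gives
  the constant \<open>(\<alpha> - 2) / 2\<close>; halving it leaves room to pass to the limit by the triangle
  inequality alone, without semicontinuity.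
\<close>

section \<open>Algebra of the functional equation for odd maps\<close>

definition defect :: "('x::real_vector \<Rightarrow> 'y::real_vector) \<Rightarrow> 'x \<Rightarrow> 'x \<Rightarrow> 'y" where
  "defect f x y = f (2 *\<^sub>R x + y) + f (2 *\<^sub>R x - y) - f (x + y) - f (x - y)
                    - 2 *\<^sub>R f (2 *\<^sub>R x) + 2 *\<^sub>R f x"

lemma odd_at_zero:
  fixes f :: "'x::group_add \<Rightarrow> 'y::real_vector"
  assumes "\<And>x. f (- x) = - f x"
  shows "f 0 = 0"
proof -
  have "2 *\<^sub>R f 0 = f 0 + f (- 0)"
    by (simp add: scaleR_2)
  also have "\<dots> = 0"
    unfolding assms by simp
  finally show ?thesis by simp
qed

text \<open>By oddness and f 0 = 0, each defect becomes a combination of the values of f at u, 2u,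
  ..., 6u. Those at u, 3u, 5u and 6u cancel, leaving 2 f(4u) - 4 f(2u). Taking x = 2u keeps all
  coefficients integral.\<close>

lemma odd_defect_doubling:
  fixes f :: "'x::real_vector \<Rightarrow> 'y::real_vector"
  assumes odd: "\<And>x. f (- x) = - f x"
  shows "2 *\<^sub>R (f (4 *\<^sub>R u) - 2 *\<^sub>R f (2 *\<^sub>R u)) =
    defect f u (4 *\<^sub>R u) + defect f u (3 *\<^sub>R u) - defect f (2 *\<^sub>R u) (2 *\<^sub>R u) - defect f u u"
proof -
  have f0: "f 0 = 0"
    using odd by (rule odd_at_zero)
  \<comment> \<open>These rules merge every argument of f into a single multiple of u, so that equal
    values are recognised and cancel.\<close>
  have add_u: "a *\<^sub>R u + b *\<^sub>R u = (a + b) *\<^sub>R u" "u + b *\<^sub>R u = (1 + b) *\<^sub>R u"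
    "a *\<^sub>R u + u = (a + 1) *\<^sub>R u" for a b
    by (simp_all add: scaleR_left_distrib)
  have diff_u: "a *\<^sub>R u - b *\<^sub>R u = (a - b) *\<^sub>R u" "u - b *\<^sub>R u = (1 - b) *\<^sub>R u"
    "a *\<^sub>R u - u = (a - 1) *\<^sub>R u" for a b
    by (simp_all add: scaleR_left_diff_distrib)
  have "u + u = 2 *\<^sub>R u"
    by (simp add: scaleR_2)
  then show ?thesis
    by (simp add: defect_def add_u diff_u odd f0)
      (simp add: scaleR_2 scaleR_right_distrib scaleR_right_diff_distrib)
qed

lemma additive_if_odd_defect_zero:
  fixes A :: "'x::real_vector \<Rightarrow> 'y::real_vector"
  assumes odd: "\<And>x. A (- x) = - A x" and zero: "\<And>x y. defect A x y = 0"
  shows "Modules.additive A"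
proof -
  \<comment> \<open>With u = x/2 all four defects vanish, so the doubling identity gives this; it
    removes the term A(2x) from the equation.\<close>
  have double: "A (2 *\<^sub>R x) = 2 *\<^sub>R A x" for x
    using odd_defect_doubling[of A "(1/2) *\<^sub>R x"] by (simp add: odd zero)
  have eq: "A (2 *\<^sub>R x + y) + A (2 *\<^sub>R x - y) = A (x + y) + A (x - y) + 2 *\<^sub>R A x" for x y
    using zero[of x y] unfolding defect_def double scaleR_2[of "2 *\<^sub>R A x"]
    by (simp add: algebra_simps)
  have six: "A (3 *\<^sub>R x + y) + A (3 *\<^sub>R x - y) = 6 *\<^sub>R A x" for x y
  proof -
    have 3: "2 *\<^sub>R x + (x + y) = 3 *\<^sub>R x + y" "2 *\<^sub>R x + (x - y) = 3 *\<^sub>R x - y" for y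
      by (simp_all add: scaleR_left_distrib[of 2 1 x, simplified])
    have 2: "2 *\<^sub>R x - (x + y) = x - y" "2 *\<^sub>R x - (x - y) = x + y"
      "x + (x + y) = 2 *\<^sub>R x + y" "x - (x + y) = - y" "x + (x - y) = 2 *\<^sub>R x - y" "x - (x - y) = y" for y
      by (simp_all add: scaleR_2)
    \<comment> \<open>Replacing y by x + y and by x - y raises the coefficient of x from 2 to 3. On
      adding the two results the terms in A y cancel, and one more use of \<open>eq\<close> produces
      A(x + y) + A(x - y), which cancels against the left side.\<close>
    have a: "A (3 *\<^sub>R x + y) + A (x - y) = A (2 *\<^sub>R x + y) + - A y + 2 *\<^sub>R A x"
      using eq[of x "x + y"] unfolding 2 3 odd .
    have b: "A (3 *\<^sub>R x - y) + A (x + y) = A (2 *\<^sub>R x - y) + A y + 2 *\<^sub>R A x"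
      using eq[of x "x - y"] unfolding 2 3 .
    have "A (3 *\<^sub>R x + y) + A (3 *\<^sub>R x - y) + (A (x + y) + A (x - y)) =
      (A (3 *\<^sub>R x + y) + A (x - y)) + (A (3 *\<^sub>R x - y) + A (x + y))"
      by (simp add: algebra_simps)
    also have "\<dots> = (A (2 *\<^sub>R x + y) + A (2 *\<^sub>R x - y)) + (2 *\<^sub>R A x + 2 *\<^sub>R A x)"
      unfolding a b by (simp add: algebra_simps)
    also have "\<dots> = 6 *\<^sub>R A x + (A (x + y) + A (x - y))"
      unfolding eq by (simp add: scaleR_left_distrib[symmetric] add.assoc)
    finally show ?thesis by simp
  qed
  have jensen: "A (z + y) + A (z - y) = 2 *\<^sub>R A z" for z y
  proof -
    \<comment> \<open>The case y = 0 of \<open>six\<close>, at z/3.\<close>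
    have "6 *\<^sub>R A ((1/3) *\<^sub>R z) = 2 *\<^sub>R A z"
      using six[of "(1/3) *\<^sub>R z" 0] by (simp add: scaleR_2)
    then show ?thesis
      using six[of "(1/3) *\<^sub>R z" y] by simp
  qed
  have "A (x + y) = A x + A y" for x y
  proof -
    \<comment> \<open>Jensen's equation centred at x and at y; the terms A(x - y) and A(y - x)
      cancel by oddness.\<close>
    have "(2::real) *\<^sub>R A (x + y) = (A (x + y) + A (x - y)) + (A (y + x) + A (y - x))"
      using odd[of "x - y"] by (simp add: scaleR_2 add.commute)
    also have "\<dots> = 2 *\<^sub>R (A x + A y)"
      unfolding jensen by (simp add: scaleR_right_distrib)
    finally show ?thesis by simp
  qed
  then show ?thesis by (simp add: Modules.additive_def)
qed

section \<open>Limits and telescoping estimates in a fuzzy norm\<close>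

context fuzzy_normed_space
begin

lemma N_le_1: "N x a \<le> 1"
  using range[of x a] by simp

lemma N_mono: "a \<le> b \<Longrightarrow> N x a \<le> N x b"
  using N5_mono by (simp add: mono_def)

lemma N_minus: "N (- x) a = N x a"
  using N3[of "-1" x a] by simp

lemma N_scale: "c > 0 \<Longrightarrow> N (c *\<^sub>R x) (c * a) = N x a"
  by (simp add: N3)

lemma N_add_ge: "m \<le> N x a \<Longrightarrow> m \<le> N y b \<Longrightarrow> m \<le> N (x + y) (a + b)"
  using N4[of x a y b] by linarith

lemma N_diff_ge: "m \<le> N x a \<Longrightarrow> m \<le> N y b \<Longrightarrow> m \<le> N (x - y) (a + b)"
  using N_add_ge[of m x a "- y" b] by (simp add: N_minus)

text \<open>\<open>N x a\<close> does not depend on n and is at most 1, so a lower bound tending to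
  1 forces it to equal 1, and N2 applies. Uniqueness of limits and of the additive map both rest on
  this.\<close>

lemma eq_zero_if_N_ge_tendsto_1:
  assumes "\<And>a n. a > 0 \<Longrightarrow> g a n \<le> N x a" "\<And>a. a > 0 \<Longrightarrow> g a \<longlonglongrightarrow> (1::real)"
  shows "x = 0"
proof -
  have "N x a = 1" if "a > 0" for a
    using LIMSEQ_le_const2[OF assms(2)[OF that], of "N x a"] assms(1)[OF that] N_le_1[of x a]
    by fastforce
  then show ?thesis using N2 by blast
qed

text \<open>Unlike \<open>fuzzy_convergent\<close>, this names the limit, so that limits can be
  added, scaled and compared.\<close>

definition fuzzy_lim :: "(nat \<Rightarrow> 'v) \<Rightarrow> 'v \<Rightarrow> bool" where
  "fuzzy_lim X x \<longleftrightarrow> (\<forall>a>0. (\<lambda>n. N (X n - x) a) \<longlonglongrightarrow> 1)"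

lemma tendsto_1_squeeze:
  assumes "g \<longlonglongrightarrow> (1::real)" "\<And>n. g n \<le> N (X n) a"
  shows "(\<lambda>n. N (X n) a) \<longlonglongrightarrow> 1"
  by (rule tendsto_sandwich[OF _ _ assms(1) tendsto_const]) (auto simp: assms(2) N_le_1)

lemma fuzzy_lim_add:
  assumes "fuzzy_lim X x" "fuzzy_lim Y y"
  shows "fuzzy_lim (\<lambda>n. X n + Y n) (x + y)"
  unfolding fuzzy_lim_def
proof (intro allI impI)
  fix a :: real assume "a > 0"
  then have lim: "(\<lambda>n. min (N (X n - x) (a/2)) (N (Y n - y) (a/2))) \<longlonglongrightarrow> min 1 1"
    using assms unfolding fuzzy_lim_def by (intro tendsto_min) auto
  have eq: "X n + Y n - (x + y) = (X n - x) + (Y n - y)" for n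
    by simp
  show "(\<lambda>n. N (X n + Y n - (x + y)) a) \<longlonglongrightarrow> 1"
    using tendsto_1_squeeze[OF lim[simplified], of "\<lambda>n. X n + Y n - (x + y)" a]
      N4[of _ "a/2" _ "a/2"] unfolding eq by simp
qed

lemma fuzzy_lim_scaleR:
  assumes "fuzzy_lim X x" "c \<noteq> 0"
  shows "fuzzy_lim (\<lambda>n. c *\<^sub>R X n) (c *\<^sub>R x)"
  using assms unfolding fuzzy_lim_def
  by (simp add: N3 scaleR_right_diff_distrib[symmetric])

lemma fuzzy_lim_minus: "fuzzy_lim X x \<Longrightarrow> fuzzy_lim (\<lambda>n. - X n) (- x)"
  using fuzzy_lim_scaleR[of X x "-1"] by simp

lemma fuzzy_lim_diff:
  "fuzzy_lim X x \<Longrightarrow> fuzzy_lim Y y \<Longrightarrow> fuzzy_lim (\<lambda>n. X n - Y n) (x - y)"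
  using fuzzy_lim_add[OF _ fuzzy_lim_minus] by fastforce

lemma fuzzy_lim_unique:
  assumes "fuzzy_lim X x" "fuzzy_lim X y"
  shows "x = y"
proof -
  have lim: "fuzzy_lim (\<lambda>n. 0) (x - y)"
    using fuzzy_lim_diff[OF assms] by simp
  have "x - y = 0"
    using lim unfolding fuzzy_lim_def
    by (intro eq_zero_if_N_ge_tendsto_1[of "\<lambda>a n. N (0 - (x - y)) a"])
      (auto simp: N_minus[of "x - y", simplified])
  then show ?thesis by simp
qed

text \<open>In N4 the widths add while the lower bound m is kept. Writing the widths as differences
  of s makes their sum collapse together with the sum of the steps of X.\<close>

lemma N_telescope:
  assumes "\<And>k. m \<le> N (X (Suc k) - X k) (s k - s (Suc k))"
  shows "m \<le> N (X (n + Suc p) - X n) (s n - s (n + Suc p))"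
proof (induction p)
  case 0
  show ?case using assms[of n] by simp
next
  case (Suc p)
  show ?case
    using N_add_ge[OF assms[of "n + Suc p"] Suc.IH] by simp
qed

end

section \<open>Hyers' method for an abstract control function \<Psi>\<close>

locale doubling_control = fuzzy_normed_space N
  for N :: "'v::real_vector \<Rightarrow> real \<Rightarrow> real" +
  fixes f :: "'x::real_vector \<Rightarrow> 'v" and \<Psi> :: "'x \<Rightarrow> real \<Rightarrow> real" and \<alpha> :: real
  assumes \<alpha>_gt_2: "\<alpha> > 2"
    and doubling: "a > 0 \<Longrightarrow> \<Psi> x a \<le> N (f (2 *\<^sub>R x) - 2 *\<^sub>R f x) (2 * a)"
    and halving: "a > 0 \<Longrightarrow> \<Psi> x (\<alpha> * a) \<le> \<Psi> ((1/2) *\<^sub>R x) a"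
    and \<Psi>_lim: "(\<Psi> x \<longlongrightarrow> 1) at_top"
begin

lemma halving_power: "a > 0 \<Longrightarrow> \<Psi> x (\<alpha> ^ n * a) \<le> \<Psi> ((1 / 2 ^ n) *\<^sub>R x) a"
proof (induction n arbitrary: a)
  case (Suc n)
  have "\<Psi> x (\<alpha> ^ n * (\<alpha> * a)) \<le> \<Psi> ((1 / 2 ^ n) *\<^sub>R x) (\<alpha> * a)"
    using Suc \<alpha>_gt_2 by auto
  also have "\<dots> \<le> \<Psi> ((1/2) *\<^sub>R (1 / 2 ^ n) *\<^sub>R x) a"
    using Suc.prems by (rule halving)
  finally show ?case by (simp add: mult_ac)
qed simp

text \<open>The ratio \<alpha> / 2 weighs the gain \<alpha> from one halving of x against the loss 2
  from rescaling; \<alpha> > 2 makes its powers unbounded.\<close>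

lemma \<Psi>_geometric_lim:
  assumes "c > 0"
  shows "(\<lambda>n. \<Psi> x ((\<alpha> / 2) ^ n * c)) \<longlonglongrightarrow> 1"
proof -
  have "filterlim (\<lambda>n. (\<alpha> / 2) ^ n) at_top sequentially"
    using \<alpha>_gt_2
    by (intro filterlim_at_infinity_imp_filterlim_at_top filterlim_realpow_sequentially_gt1) simp_all
  then have "filterlim (\<lambda>n. (\<alpha> / 2) ^ n * c) at_top sequentially"
    using assms by (intro filterlim_at_top_mult_tendsto_pos[OF tendsto_const])
  then show ?thesis by (rule filterlim_compose[OF \<Psi>_lim])
qed

definition hyers :: "'x \<Rightarrow> nat \<Rightarrow> 'v" where
  "hyers x n = 2 ^ n *\<^sub>R f ((1 / 2 ^ n) *\<^sub>R x)"

lemma hyers_0: "hyers x 0 = f x"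
  by (simp add: hyers_def)

text \<open>Moving from x to x / 2^(k+1) divides the width by \<alpha>^(k+1). The factor 2 in
  \<open>doubling\<close> and the scaling by 2^k multiply it by 2^(k+1), whence the rate 2 /
  \<alpha>.\<close>

lemma hyers_step:
  assumes "b > 0"
  shows "\<Psi> x b \<le> N (hyers x (Suc k) - hyers x k) ((2 / \<alpha>) ^ Suc k * b)"
proof -
  define z where "z = (1 / 2 ^ Suc k) *\<^sub>R x"
  have pos: "b / \<alpha> ^ Suc k > 0"
    using assms \<alpha>_gt_2 by simp
  have "\<Psi> x b = \<Psi> x (\<alpha> ^ Suc k * (b / \<alpha> ^ Suc k))"
    using \<alpha>_gt_2 by simp
  also have "\<dots> \<le> \<Psi> z (b / \<alpha> ^ Suc k)"
    unfolding z_def by (rule halving_power[OF pos])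
  also have "\<dots> \<le> N (f (2 *\<^sub>R z) - 2 *\<^sub>R f z) (2 * (b / \<alpha> ^ Suc k))"
    by (rule doubling[OF pos])
  also have "\<dots> = N (2 ^ k *\<^sub>R (f (2 *\<^sub>R z) - 2 *\<^sub>R f z)) (2 ^ k * (2 * (b / \<alpha> ^ Suc k)))"
    by (rule N_scale[symmetric]) simp
  also have "2 ^ k *\<^sub>R (f (2 *\<^sub>R z) - 2 *\<^sub>R f z) = - (hyers x (Suc k) - hyers x k)"
    by (simp add: z_def hyers_def scaleR_right_diff_distrib mult.commute)
  also have "2 ^ k * (2 * (b / \<alpha> ^ Suc k)) = (2 / \<alpha>) ^ Suc k * b"
    by (simp add: power_divide)
  finally show ?thesis unfolding N_minus .
qed

lemma hyers_diff:
  assumes "b > 0"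
  shows "\<Psi> x b \<le> N (hyers x (n + Suc p) - hyers x n) (2 * b / (\<alpha> - 2) * (2 / \<alpha>) ^ n)"
proof -
  \<comment> \<open>The tail from index k of the geometric series of the widths in
    \<open>hyers_step\<close>, so its successive differences are exactly these widths.\<close>
  define s where "s k = 2 * b / (\<alpha> - 2) * (2 / \<alpha>) ^ k" for k
  have "s k - s (Suc k) = (2 / \<alpha>) ^ Suc k * b" for k
  proof -
    have "s k - s (Suc k) = (2 / \<alpha>) ^ k * (2 * b / (\<alpha> - 2) * (1 - 2 / \<alpha>))"
      unfolding s_def power_Suc
      by (simp only: right_diff_distrib left_diff_distrib mult_1 mult_1_right mult_ac)
    also have "2 * b / (\<alpha> - 2) * (1 - 2 / \<alpha>) = (2 / \<alpha>) * b"
      using \<alpha>_gt_2 by (simp add: field_simps)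
    finally show ?thesis by simp
  qed
  then have "\<Psi> x b \<le> N (hyers x (n + Suc p) - hyers x n) (s n - s (n + Suc p))"
    using hyers_step[OF assms] by (intro N_telescope) simp
  also have "\<dots> \<le> N (hyers x (n + Suc p) - hyers x n) (s n)"
    using assms \<alpha>_gt_2 by (intro N_mono) (simp add: s_def)
  finally show ?thesis by (simp add: s_def)
qed

lemma hyers_Cauchy: "fuzzy_Cauchy N (hyers x)"
  unfolding fuzzy_Cauchy_def
proof (intro allI impI)
  fix e a :: real assume e: "e > 0" and a: "a > 0"
  \<comment> \<open>With b = (\<alpha>/2)^n * c, the width in \<open>hyers_diff\<close> equals a for
    every n.\<close>
  define c where "c = a * (\<alpha> - 2) / 2"
  have c: "c > 0" using a \<alpha>_gt_2 by (simp add: c_def)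
  have "eventually (\<lambda>n. 1 - e < \<Psi> x ((\<alpha> / 2) ^ n * c)) sequentially"
    using \<Psi>_geometric_lim[OF c] e by (intro order_tendstoD) auto
  then obtain M where M: "\<And>n. n \<ge> M \<Longrightarrow> 1 - e < \<Psi> x ((\<alpha> / 2) ^ n * c)"
    by (auto simp: eventually_sequentially)
  have "1 - e < N (hyers x (n + p) - hyers x n) a" if "n \<ge> M" "p > 0" for n p
  proof -
    obtain q where q: "p = Suc q" using \<open>p > 0\<close> gr0_implies_Suc by blast
    have "2 * ((\<alpha> / 2) ^ n * c) / (\<alpha> - 2) * (2 / \<alpha>) ^ n = a"
    proof -
      have "(\<alpha> / 2) ^ n * (2 / \<alpha>) ^ n = 1"
        using \<alpha>_gt_2 by (simp flip: power_mult_distrib)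
      moreover have "2 * ((\<alpha> / 2) ^ n * c) / (\<alpha> - 2) * (2 / \<alpha>) ^ n
          = (\<alpha> / 2) ^ n * (2 / \<alpha>) ^ n * (2 * c / (\<alpha> - 2))"
        by simp
      moreover have "2 * c / (\<alpha> - 2) = a"
        using \<alpha>_gt_2 by (simp add: c_def nonzero_divide_eq_eq)
      ultimately show ?thesis by simp
    qed
    then have "\<Psi> x ((\<alpha> / 2) ^ n * c) \<le> N (hyers x (n + p) - hyers x n) a"
      using hyers_diff[of "(\<alpha> / 2) ^ n * c" x n q] c \<alpha>_gt_2 q by simp
    with M[OF \<open>n \<ge> M\<close>] show ?thesis by simp
  qed
  then show "\<exists>n\<^sub>0. \<forall>n\<ge>n\<^sub>0. \<forall>p>0. N (hyers x (n + p) - hyers x n) a > 1 - e"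
    by blast
qed

lemma hyers_limit_approx:
  assumes "fuzzy_lim (hyers x) y" "a > 0"
  shows "\<Psi> x (a * (\<alpha> - 2) / 4) \<le> N (y - f x) a"
proof -
  define m where "m = \<Psi> x (a * (\<alpha> - 2) / 4)"
  \<comment> \<open>Half of the width a pays for the distance from f x to the Hyers sequence,
    estimated from index 0; the other half pays for the distance from the sequence to y.\<close>
  have half: "2 * (a * (\<alpha> - 2) / 4) / (\<alpha> - 2) = a / 2"
    using \<alpha>_gt_2 by (simp add: nonzero_divide_eq_eq)
  have m: "m \<le> N (hyers x (Suc n) - f x) (a / 2)" for n
    using hyers_diff[of "a * (\<alpha> - 2) / 4" x 0 n, unfolded half] assms(2) \<alpha>_gt_2
    by (simp add: m_def hyers_0)
  have "(\<lambda>n. N (hyers x (Suc n) - y) (a / 2)) \<longlonglongrightarrow> 1"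
    using assms unfolding fuzzy_lim_def
    by (intro LIMSEQ_Suc[of "\<lambda>n. N (hyers x n - y) (a / 2)"]) simp
  then have lim: "(\<lambda>n. min m (N (hyers x (Suc n) - y) (a / 2))) \<longlonglongrightarrow> min m 1"
    by (intro tendsto_intros)
  have "min m (N (hyers x (Suc n) - y) (a / 2)) \<le> N (y - f x) a" for n
    using N_diff_ge[of "min m (N (hyers x (Suc n) - y) (a / 2))" "hyers x (Suc n) - f x" "a/2"
        "hyers x (Suc n) - y" "a/2"] m[of n] by simp
  then have "min m 1 \<le> N (y - f x) a"
    by (intro LIMSEQ_le_const2[OF lim]) auto
  moreover have "m \<le> 1"
    using m[of 0] N_le_1 order_trans by blast
  ultimately show ?thesis by (simp add: m_def)
qed

text \<open>The difference C of the two maps satisfies C x = 2^n C(x / 2^n). Both maps are close to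
  f at x / 2^n, and the control there, rescaled to x, tends to 1; so C x = 0.\<close>

lemma additive_approx_unique:
  assumes "Modules.additive A" "Modules.additive B" and c: "c > 0"
    and A: "\<And>x a. a > 0 \<Longrightarrow> \<Psi> x (a * c) \<le> N (A x - f x) a"
    and B: "\<And>x a. a > 0 \<Longrightarrow> \<Psi> x (a * c) \<le> N (B x - f x) a"
  shows "A = B"
proof
  fix x
  define C where "C x = A x - B x" for x
  interpret C: Modules.additive C
    using assms(1,2) by (simp add: C_def Modules.additive_def)
  have C2: "C x = 2 ^ n *\<^sub>R C ((1 / 2 ^ n) *\<^sub>R x)" for n
  proof (induction n)
    case (Suc n)
    have "C ((1 / 2 ^ n) *\<^sub>R x) = 2 *\<^sub>R C ((1 / 2 ^ Suc n) *\<^sub>R x)"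
      using C.add[of "(1 / 2 ^ Suc n) *\<^sub>R x" "(1 / 2 ^ Suc n) *\<^sub>R x"]
      by (simp add: scaleR_2[symmetric])
    with Suc show ?case by (simp add: mult.commute)
  qed simp
  have "\<Psi> x ((\<alpha> / 2) ^ n * (a * c / 2)) \<le> N (C x) a" if "a > 0" for a n
  proof -
    \<comment> \<open>Scaling by 2^n turns width a / 2^n into a; each of the two approximations
      receives half of it.\<close>
    let ?z = "(1 / 2 ^ n) *\<^sub>R x" and ?b = "a / 2 ^ n / 2"
    have b: "?b > 0" using that by simp
    have "\<Psi> x ((\<alpha> / 2) ^ n * (a * c / 2)) = \<Psi> x (\<alpha> ^ n * (?b * c))"
      by (simp add: power_divide)
    also have "\<dots> \<le> \<Psi> ?z (?b * c)"
      using b c by (intro halving_power mult_pos_pos)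
    also have "\<dots> \<le> N ((A ?z - f ?z) - (B ?z - f ?z)) (?b + ?b)"
      by (rule N_diff_ge[OF A[OF b] B[OF b]])
    also have "\<dots> = N (C ?z) (a / 2 ^ n)"
      by (simp add: C_def)
    also have "\<dots> = N (C x) a"
      using N_scale[of "2 ^ n" "C ?z" "a / 2 ^ n"] C2[of n] by simp
    finally show ?thesis .
  qed
  moreover have "(\<lambda>n. \<Psi> x ((\<alpha> / 2) ^ n * (a * c / 2))) \<longlonglongrightarrow> 1" if "a > 0" for a
    using that c by (intro \<Psi>_geometric_lim) simp
  ultimately have "C x = 0"
    by (rule eq_zero_if_N_ge_tendsto_1)
  then show "A x = B x" by (simp add: C_def)
qed

end

section \<open>The minimum \<open>N4''\<close> as a control function\<close>

lemma le_N4''_iff: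
  "m \<le> N4'' N' \<phi> x a \<longleftrightarrow> m \<le> N' (\<phi> x x) a
    \<and> m \<le> N' (\<phi> ((1/2) *\<^sub>R x) ((1/2) *\<^sub>R x)) a
    \<and> m \<le> N' (\<phi> ((1/2) *\<^sub>R x) (2 *\<^sub>R x)) a
    \<and> m \<le> N' (\<phi> ((1/2) *\<^sub>R x) ((3/2) *\<^sub>R x)) a"
  by (simp add: N4''_def)

lemma (in fuzzy_normed_space) N4''_tendsto_1: "(N4'' N \<phi> x \<longlongrightarrow> 1) at_top"
proof -
  have "((\<lambda>a. min (N (\<phi> x x) a) (min (N (\<phi> ((1/2) *\<^sub>R x) ((1/2) *\<^sub>R x)) a)
      (min (N (\<phi> ((1/2) *\<^sub>R x) (2 *\<^sub>R x)) a) (N (\<phi> ((1/2) *\<^sub>R x) ((3/2) *\<^sub>R x)) a))))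
      \<longlongrightarrow> min 1 (min 1 (min 1 1))) at_top"
    by (intro tendsto_min N5_lim)
  then show ?thesis by (simp add: N4''_def[abs_def])
qed

lemma N4''_halving:
  assumes "\<forall>x. \<forall>y\<in>{x, (1/2) *\<^sub>R x, (3/2) *\<^sub>R x, 2 *\<^sub>R x}. \<forall>a>0.
      N' (\<phi> ((1/2) *\<^sub>R ((1/2) *\<^sub>R x)) ((1/2) *\<^sub>R y)) a \<ge> N' (\<phi> ((1/2) *\<^sub>R x) y) (\<alpha> * a)"
    and "a > 0"
  shows "N4'' N' \<phi> x (\<alpha> * a) \<le> N4'' N' \<phi> ((1/2) *\<^sub>R x) a"
proof -
  have half: "N' (\<phi> ((1/2) *\<^sub>R z) y) (\<alpha> * a) \<le> N' (\<phi> ((1/2) *\<^sub>R ((1/2) *\<^sub>R z)) ((1/2) *\<^sub>R y)) a"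
    if "y \<in> {z, (1/2) *\<^sub>R z, (3/2) *\<^sub>R z, 2 *\<^sub>R z}" for z y
    using assms that by blast
  note le = le_N4''_iff[of "N4'' N' \<phi> x (\<alpha> * a)" N' \<phi> x "\<alpha> * a", simplified]
  show ?thesis
    unfolding le_N4''_iff
    \<comment> \<open>Each of the four pairs at x is sent to its own half. The pair (x, x) is
      reached with z = 2x and y = z/2, the other three with z = x.\<close>
    using le half[of x "2 *\<^sub>R x"] half[of "(1/2) *\<^sub>R x" x] half[of "(3/2) *\<^sub>R x" x]
      half[of "2 *\<^sub>R x" x]
    by (auto intro: order_trans)
qed

text \<open>Four defects of width a give width 4a for twice the doubling difference, hence 2a for
  the difference itself.\<close>

lemma (in fuzzy_normed_space) N_doubling_ge_N4'':
  assumes odd: "\<And>x. f (- x) = - f x"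
    and bound: "\<And>x y. N' (\<phi> x y) a \<le> N (defect f x y) a"
  shows "N4'' N' \<phi> x a \<le> N (f (2 *\<^sub>R x) - 2 *\<^sub>R f x) (2 * a)"
proof -
  let ?u = "(1/2) *\<^sub>R x" and ?m = "N4'' N' \<phi> x a"
  have m: "?m \<le> N (defect f x x) a" "?m \<le> N (defect f ?u ?u) a"
    "?m \<le> N (defect f ?u (2 *\<^sub>R x)) a" "?m \<le> N (defect f ?u ((3/2) *\<^sub>R x)) a"
    using le_N4''_iff[of ?m N' \<phi> x a, simplified] bound order_trans by blast+
  have "?m \<le> N (defect f ?u (2 *\<^sub>R x) + defect f ?u ((3/2) *\<^sub>R x) - defect f x x - defect f ?u ?u)
      (a + a + a + a)"
    by (intro N_add_ge N_diff_ge m)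
  also have "defect f ?u (2 *\<^sub>R x) + defect f ?u ((3/2) *\<^sub>R x) - defect f x x - defect f ?u ?u
      = 2 *\<^sub>R (f (2 *\<^sub>R x) - 2 *\<^sub>R f x)"
    using odd_defect_doubling[of f ?u] by (simp add: odd)
  also have "a + a + a + a = 2 * (2 * a)" by simp
  finally show ?thesis by (simp only: N_scale[of 2, simplified])
qed

theorem theorem2p4:
  fixes N :: "'y::real_vector \<Rightarrow> real \<Rightarrow> real"
    and N' :: "'z::real_vector \<Rightarrow> real \<Rightarrow> real"
    and \<phi>\<^sub>4 :: "'x::real_vector \<Rightarrow> 'x \<Rightarrow> 'z"
    and f :: "'x \<Rightarrow> 'y"
    and \<alpha> :: real
  assumes "fuzzy_Banach_space N"
    and "fuzzy_normed_space N'"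
    and "\<alpha> > 2"
    and "\<forall>x. \<forall>y\<in>{x, (1/2) *\<^sub>R x, (3/2) *\<^sub>R x, 2 *\<^sub>R x}. \<forall>a>0.
           N' (\<phi>\<^sub>4 ((1/2) *\<^sub>R ((1/2) *\<^sub>R x)) ((1/2) *\<^sub>R y)) a
             \<ge> N' (\<phi>\<^sub>4 ((1/2) *\<^sub>R x) y) (\<alpha> * a)"
    and "\<forall>x y. \<forall>a>0.
           (\<lambda>n. N' (2 ^ n *\<^sub>R \<phi>\<^sub>4 ((1 / 2 ^ n) *\<^sub>R x) ((1 / 2 ^ n) *\<^sub>R y)) a) \<longlonglongrightarrow> 1"
    and "\<forall>x. f (- x) = - f x"
    and "\<forall>x y. \<forall>a>0.
           N (f (2 *\<^sub>R x + y) + f (2 *\<^sub>R x - y) - f (x + y) - f (x - y)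
                - 2 *\<^sub>R f (2 *\<^sub>R x) + 2 *\<^sub>R f x) a
             \<ge> N' (\<phi>\<^sub>4 x y) a"
  shows "\<exists>!A :: 'x \<Rightarrow> 'y. Modules.additive A \<and>
           (\<forall>x. \<forall>a>0. N (A x - f x) a \<ge> N4'' N' \<phi>\<^sub>4 x (a * (\<alpha> - 2) / 4))"
proof -
  interpret N: fuzzy_Banach_space N by fact
  interpret N': fuzzy_normed_space N' by fact
  have odd: "f (- x) = - f x" for x
    using assms(6) by blast
  have bound: "N' (\<phi>\<^sub>4 x y) a \<le> N (defect f x y) a" if "a > 0" for x y a
    using assms(7) that unfolding defect_def by blast
  interpret doubling_control N f "N4'' N' \<phi>\<^sub>4" \<alpha>
  proof unfold_locales
    show "\<alpha> > 2" by fact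
    show "N4'' N' \<phi>\<^sub>4 x a \<le> N (f (2 *\<^sub>R x) - 2 *\<^sub>R f x) (2 * a)" if "a > 0" for x a
      using odd bound[OF that] by (rule N.N_doubling_ge_N4'')
    show "N4'' N' \<phi>\<^sub>4 x (\<alpha> * a) \<le> N4'' N' \<phi>\<^sub>4 ((1/2) *\<^sub>R x) a" if "a > 0" for x a
      using assms(4) that by (rule N4''_halving)
    show "(N4'' N' \<phi>\<^sub>4 x \<longlongrightarrow> 1) at_top" for x
      by (rule N'.N4''_tendsto_1)
  qed
  have "\<exists>y. N.fuzzy_lim (hyers x) y" for x
    using N.complete[OF hyers_Cauchy[of x]] unfolding fuzzy_convergent_def N.fuzzy_lim_def .
  then obtain A where lim: "\<And>x. N.fuzzy_lim (hyers x) (A x)"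
    by metis
  have A_odd: "A (- x) = - A x" for x
    using lim[of "- x"] N.fuzzy_lim_minus[OF lim[of x]]
    by (intro N.fuzzy_lim_unique) (simp_all add: hyers_def[abs_def] odd)
  have "defect A x y = 0" for x y
  proof -
    let ?D = "\<lambda>n. 2 ^ n *\<^sub>R defect f ((1 / 2 ^ n) *\<^sub>R x) ((1 / 2 ^ n) *\<^sub>R y)"
    \<comment> \<open>The defect is linear in the map, so it commutes with the limit and with the
      factor 2^n of the Hyers approximants.\<close>
    have "N.fuzzy_lim (\<lambda>n. defect (\<lambda>x. hyers x n) x y) (defect A x y)"
      unfolding defect_def
      by (intro N.fuzzy_lim_add N.fuzzy_lim_diff N.fuzzy_lim_scaleR lim) simp_all
    also have "(\<lambda>n. defect (\<lambda>x. hyers x n) x y) = ?D"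
      by (simp add: defect_def hyers_def scaleR_right_distrib scaleR_right_diff_distrib mult.commute)
    finally have 1: "N.fuzzy_lim ?D (defect A x y)" .
    have "(\<lambda>n. N (?D n) a) \<longlonglongrightarrow> 1" if "a > 0" for a
    proof (rule N.tendsto_1_squeeze)
      show "(\<lambda>n. N' (2 ^ n *\<^sub>R \<phi>\<^sub>4 ((1 / 2 ^ n) *\<^sub>R x) ((1 / 2 ^ n) *\<^sub>R y)) a) \<longlonglongrightarrow> 1"
        using assms(5) that by blast
      show "N' (2 ^ n *\<^sub>R \<phi>\<^sub>4 ((1 / 2 ^ n) *\<^sub>R x) ((1 / 2 ^ n) *\<^sub>R y)) a \<le> N (?D n) a" for n
        \<comment> \<open>The bound on f at the scaled points with width a / 2^n, multiplied by 2^n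
          on both sides.\<close>
        using bound[of "a / 2 ^ n"] that by (simp add: N.N3 N'.N3)
    qed
    then have "N.fuzzy_lim ?D 0"
      by (simp add: N.fuzzy_lim_def)
    with 1 show ?thesis by (rule N.fuzzy_lim_unique)
  qed
  with A_odd have "Modules.additive A"
    by (rule additive_if_odd_defect_zero)
  moreover have "N4'' N' \<phi>\<^sub>4 x (a * (\<alpha> - 2) / 4) \<le> N (A x - f x) a" if "a > 0" for x a
    using lim that by (rule hyers_limit_approx)
  moreover have "B = A" if "Modules.additive B"
    "\<forall>x. \<forall>a>0. N4'' N' \<phi>\<^sub>4 x (a * (\<alpha> - 2) / 4) \<le> N (B x - f x) a" for B
    using that calculation \<open>\<alpha> > 2\<close>
    by (intro additive_approx_unique[of B A "(\<alpha> - 2) / 4"]) simp_all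
  ultimately show ?thesis by blast
qed

end
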